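(* For any integers $d\ge 0$ and $n\ge 2(d+1)$, every $\mathbf{B}_{n,d}$-free graph $G$ satisfies $\chi(G)\le g_{n,d}(\omega(G))$; that is, the class of $\mathbf{B}_{n,d}$-free graphs is $\chi$-bounded by $g_{n,d}$.
   Context: Graphs are finite and simple; $\chi$ is the chromatic number and $\omega$ the clique number. For a set $\mathbf{H}$ of graphs, a graph is $\mathbf{H}$-free if it has no induced subgraph isomorphic to a member of $\mathbf{H}$. $G\cup H$ denotes disjoint union and $G+H$ the join ($G\cup H$ plus all edges between $G$ and $H$); for a set $\mathbf{H}$, $G\cup\mathbf{H}=\{G\cup H: H\in\mathbf{H}\}$ and $G+\mathbf{H}=\{G+H:H\in\mathbf{H}\}$. $K_m$ is the complete graph on $m$ vertices ($K_0$ empty). Define $\mathbf{B}_{n,0}$ ($n\ge2$) as the set of graphs on $n$ vertices of maximum degree $n-1$, and for $d>0$, $n\ge 2(d+1)$, \[\mathbf{B}_{n,d}=\bigcup_{m=2d}^{n-2} K_{n-m-2}+(K_2\cup \mathbf{B}_{m,d-1}).\] For $d\ge0$, $n\ge2(d+1)$, define $g_{n,d}$ on positive integers by $g_{n,d}(1)=1$; $g_{n,0}(\omega)=n-1$ for $\omega>1$; and for $d>0,\omega>1$, $g_{n,d}(\omega)=\sum_{k=1}^{\omega}(\omega-k+1)\,g_{\max(n+k-\omega-2,2d),d-1}(k)$. *)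

theory Defs
  imports Main
begin

datatype 'a graph = Graph (verts: "'a set") (edges: "'a set set")

definition simple_graph :: "'a graph \<Rightarrow> bool" where
  "simple_graph G \<longleftrightarrow> finite (verts G) \<and> (\<forall>e\<in>edges G. e \<subseteq> verts G \<and> card e = 2)"

definition graph_iso :: "'a graph \<Rightarrow> 'b graph \<Rightarrow> bool" (infix "\<cong>" 50) where
  "G \<cong> H \<longleftrightarrow> (\<exists>f. bij_betw f (verts G) (verts H) \<and>
     (\<forall>u\<in>verts G. \<forall>v\<in>verts G. {u, v} \<in> edges G \<longleftrightarrow> {f u, f v} \<in> edges H))"

definition induced_subgraph :: "'a graph \<Rightarrow> 'a set \<Rightarrow> 'a graph" where
  "induced_subgraph G S = Graph S {e \<in> edges G. e \<subseteq> S}"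

definition is_free :: "'b graph set \<Rightarrow> 'a graph \<Rightarrow> bool" where
  "is_free \<H> G \<longleftrightarrow> \<not> (\<exists>S H. S \<subseteq> verts G \<and> H \<in> \<H> \<and> induced_subgraph G S \<cong> H)"

definition degree :: "'a graph \<Rightarrow> 'a \<Rightarrow> nat" where
  "degree G v = card {u \<in> verts G. {u, v} \<in> edges G}"

definition max_degree :: "'a graph \<Rightarrow> nat" where
  "max_degree G = Max (degree G ` verts G)"

definition is_clique :: "'a graph \<Rightarrow> 'a set \<Rightarrow> bool" where
  "is_clique G S \<longleftrightarrow> S \<subseteq> verts G \<and> (\<forall>u\<in>S. \<forall>v\<in>S. u \<noteq> v \<longrightarrow> {u, v} \<in> edges G)"

definition clique_number :: "'a graph \<Rightarrow> nat" where
  "clique_number G = Max {card S | S. is_clique G S}"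

definition is_coloring :: "'a graph \<Rightarrow> nat \<Rightarrow> ('a \<Rightarrow> nat) \<Rightarrow> bool" where
  "is_coloring G k c \<longleftrightarrow> c ` verts G \<subseteq> {..<k} \<and>
     (\<forall>u\<in>verts G. \<forall>v\<in>verts G. {u, v} \<in> edges G \<longrightarrow> c u \<noteq> c v)"

definition chromatic_number :: "'a graph \<Rightarrow> nat" where
  "chromatic_number G = (LEAST k. \<exists>c. is_coloring G k c)"

definition complete_graph :: "nat \<Rightarrow> nat graph" where
  "complete_graph m = Graph {..<m} {e. e \<subseteq> {..<m} \<and> card e = 2}"

definition disjoint_union :: "'a graph \<Rightarrow> 'b graph \<Rightarrow> ('a + 'b) graph" where
  "disjoint_union G H =
     Graph (verts G <+> verts H) ((`) Inl ` edges G \<union> (`) Inr ` edges H)"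

definition join :: "'a graph \<Rightarrow> 'b graph \<Rightarrow> ('a + 'b) graph" where
  "join G H =
     Graph (verts G <+> verts H)
       (edges (disjoint_union G H) \<union> {{Inl u, Inr v} | u v. u \<in> verts G \<and> v \<in> verts H})"

text \<open>
  Sets of graphs are understood up to isomorphism. Since disjoint union and join change the
  vertex type, \<open>B n d\<close> consists of all copies of its members with natural numbers as vertices.
\<close>

primrec B :: "nat \<Rightarrow> nat \<Rightarrow> nat graph set" where
  B_0: "B n 0 = {H. simple_graph H \<and> card (verts H) = n \<and> max_degree H = n - 1}"
| B_Suc: "B n (Suc d) = {H. simple_graph H \<and>
     (\<exists>F \<in> (\<Union>m\<in>{2 * Suc d..n - 2}.
               join (complete_graph (n - m - 2)) ` disjoint_union (complete_graph 2) ` B m d).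
        H \<cong> F)}"

text \<open>
  The value at \<open>\<omega> = 0\<close> is a convention that only serves the graph without vertices; the sum
  starts at \<open>k = 1\<close> and never uses it. The truncated subtraction \<open>n + k - \<omega> - 2\<close> is harmless
  because of the maximum with a natural number.
\<close>

primrec g :: "nat \<Rightarrow> nat \<Rightarrow> nat \<Rightarrow> nat" where
  g_0: "g n 0 \<omega> = (if \<omega> = 0 then 0 else if \<omega> = 1 then 1 else n - 1)"
| g_Suc: "g n (Suc d) \<omega> = (if \<omega> = 0 then 0 else if \<omega> = 1 then 1 else
     (\<Sum>k = 1..\<omega>. (\<omega> - k + 1) * g (max (n + k - \<omega> - 2) (2 * Suc d)) d k))"

end

(*
  Fix a maximum clique v_0, ..., v_{w-1}. By maximality every vertex misses some v_i, where each
  v_i counts as missing itself. The vertices missing only v_i form a stable set, which accounts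
  for the summand k = 1 of g. The vertices whose first two missed clique vertices are v_i and v_j,
  i < j, are joined completely to the other j - 1 vertices among v_0, ..., v_{j-1}, so they induce
  a graph of clique number at most k = w - j + 1; and since {v_i, v_j} is an edge sending no edge to
  them, they induce a graph that is free of B_{m,d-1} for m = max (n - j - 1) (2 d). There are
  j = w - k + 1 choices of i, so induction on d gives the recursion for g.
*)
theory Submission
  imports Defs
begin

section \<open>Isomorphisms and copies\<close>

lemma graph_iso_trans: "G \<cong> H \<Longrightarrow> H \<cong> K \<Longrightarrow> G \<cong> K"
  unfolding graph_iso_def
  by (elim exE conjE, rule_tac x = "fa \<circ> f" in exI)
     (auto intro: bij_betw_trans dest: bij_betwE)

lemma graph_iso_sym: "G \<cong> H \<Longrightarrow> H \<cong> G"
proof -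
  assume "G \<cong> H"
  then obtain f where f: "bij_betw f (verts G) (verts H)"
    "\<And>u v. u \<in> verts G \<Longrightarrow> v \<in> verts G \<Longrightarrow> {u, v} \<in> edges G \<longleftrightarrow> {f u, f v} \<in> edges H"
    unfolding graph_iso_def by blast
  let ?h = "the_inv_into (verts G) f"
  have h: "bij_betw ?h (verts H) (verts G)"
    using f(1) by (rule bij_betw_the_inv_into)
  moreover have "{u, v} \<in> edges H \<longleftrightarrow> {?h u, ?h v} \<in> edges G"
    if "u \<in> verts H" "v \<in> verts H" for u v
    using f(2)[of "?h u" "?h v"] bij_betwE[OF h] that f(1)
    by (simp add: f_the_inv_into_f_bij_betw)
  ultimately show ?thesis unfolding graph_iso_def by blast
qed

lemma verts_induced_subgraph [simp]: "verts (induced_subgraph G S) = S"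
  by (simp add: induced_subgraph_def)

lemma edges_induced_subgraph [simp]:
  "edges (induced_subgraph G S) = {e \<in> edges G. e \<subseteq> S}"
  by (simp add: induced_subgraph_def)

lemma induced_subgraph_twice:
  "S \<subseteq> T \<Longrightarrow> induced_subgraph (induced_subgraph G T) S = induced_subgraph G S"
  by (auto simp: induced_subgraph_def)

lemma simple_graph_induced: "simple_graph G \<Longrightarrow> S \<subseteq> verts G \<Longrightarrow> simple_graph (induced_subgraph G S)"
  by (auto simp: simple_graph_def intro: finite_subset)

lemma simple_graph_no_loop: "simple_graph G \<Longrightarrow> {x, y} \<in> edges G \<Longrightarrow> x \<noteq> y"
  by (force simp: simple_graph_def)

text \<open>Members of \<open>B n d\<close> have natural numbers as vertices, so a subgraph found in
  a graph over \<open>'a\<close> must be renamed before it can be recognised as one of them.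
  Finiteness provides the injection.\<close>

lemma ex_nat_copy:
  assumes "simple_graph G"
  shows "\<exists>H :: nat graph. simple_graph H \<and> G \<cong> H"
proof -
  from assms have "finite (verts G)" by (simp add: simple_graph_def)
  then obtain h :: "'a \<Rightarrow> nat" where h: "inj_on h (verts G)"
    using finite_imp_inj_to_nat_seg by blast
  have sub: "e \<subseteq> verts G" if "e \<in> edges G" for e
    using that assms by (simp add: simple_graph_def)
  define H where "H = Graph (h ` verts G) ((`) h ` edges G)"
  have "simple_graph H"
    using assms h by (auto simp: H_def simple_graph_def card_image inj_on_subset)
  moreover have "G \<cong> H"
    unfolding graph_iso_def
  proof (intro exI conjI ballI)
    show "bij_betw h (verts G) (verts H)"
      using h by (simp add: H_def bij_betw_def)
    fix u v assume uv: "u \<in> verts G" "v \<in> verts G"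
    \<comment> \<open>Subsets of \<open>verts G\<close> with the same image under \<open>h\<close>
      coincide, so renaming creates no edge on a nonadjacent pair.\<close>
    have "e = {u, v}" if "e \<in> edges G" "h ` {u, v} = h ` e" for e
      using inj_on_image_eq_iff[OF h, of "{u, v}" e] that uv sub by auto
    then show "{u, v} \<in> edges G \<longleftrightarrow> {h u, h v} \<in> edges H"
      by (auto simp: H_def image_iff)
  qed
  ultimately show ?thesis by blast
qed

section \<open>Degrees under isomorphism\<close>

lemma degree_iso:
  assumes "bij_betw f (verts G) (verts H)"
    and "\<And>u v. u \<in> verts G \<Longrightarrow> v \<in> verts G \<Longrightarrow> {u, v} \<in> edges G \<longleftrightarrow> {f u, f v} \<in> edges H"
    and "v \<in> verts G"
  shows "degree H (f v) = degree G v"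
proof -
  have "verts H = f ` verts G" using assms(1) by (simp add: bij_betw_def)
  then have "{u \<in> verts H. {u, f v} \<in> edges H} = f ` {u \<in> verts G. {u, v} \<in> edges G}"
    using assms(2,3) by (auto simp: image_iff)
  moreover have "inj_on f {u \<in> verts G. {u, v} \<in> edges G}"
    by (rule inj_on_subset[OF bij_betw_imp_inj_on[OF assms(1)]]) simp
  ultimately show ?thesis by (simp add: degree_def card_image)
qed

lemma max_degree_iso:
  assumes "G \<cong> H"
  shows "max_degree G = max_degree H"
proof -
  from assms obtain f where f: "bij_betw f (verts G) (verts H)"
    "\<And>u v. u \<in> verts G \<Longrightarrow> v \<in> verts G \<Longrightarrow> {u, v} \<in> edges G \<longleftrightarrow> {f u, f v} \<in> edges H"
    unfolding graph_iso_def by blast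
  have "degree H ` verts H = degree G ` verts G"
    using degree_iso[OF f] unfolding bij_betw_imp_surj_on[OF f(1), symmetric] image_image
    by (rule image_cong[OF refl])
  then show ?thesis by (simp add: max_degree_def)
qed

lemma card_verts_iso: "G \<cong> H \<Longrightarrow> card (verts G) = card (verts H)"
  by (auto simp: graph_iso_def bij_betw_same_card)

section \<open>Adjacency in disjoint unions and joins\<close>

lemma edges_disjoint_union:
  "e \<in> edges (disjoint_union P Q) \<longleftrightarrow>
     (\<exists>e'\<in>edges P. e = Inl ` e') \<or> (\<exists>e'\<in>edges Q. e = Inr ` e')"
  unfolding disjoint_union_def graph.sel by blast

lemma not_in_edges_Inl_Inr:
  "{Inl u, Inr v} \<notin> edges (disjoint_union P Q)"
  "{Inr v, Inl u} \<notin> edges (disjoint_union P Q)"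
  unfolding edges_disjoint_union by blast+

lemma doubleton_eq_image_iff: "inj f \<Longrightarrow> {f u, f v} = f ` e \<longleftrightarrow> {u, v} = e"
  using inj_image_eq_iff[of f "{u, v}" e] by simp

lemma doubleton_neq_image: "{Inl u, Inl v} \<noteq> Inr ` e" "{Inr u', Inr v'} \<noteq> Inl ` e'"
  by blast+

lemma in_edges_disjoint_union:
  "{Inl u, Inl v} \<in> edges (disjoint_union P Q) \<longleftrightarrow> {u, v} \<in> edges P"
  "{Inr u', Inr v'} \<in> edges (disjoint_union P Q) \<longleftrightarrow> {u', v'} \<in> edges Q"
  unfolding edges_disjoint_union
  by (simp_all only: doubleton_neq_image doubleton_eq_image_iff inj_Inl inj_Inr) simp_all

lemma edges_join:
  "e \<in> edges (join P Q) \<longleftrightarrow>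
     e \<in> edges (disjoint_union P Q) \<or> (\<exists>u\<in>verts P. \<exists>v\<in>verts Q. e = {Inl u, Inr v})"
  unfolding join_def graph.sel by blast

lemma in_edges_join:
  "{Inl u, Inl v} \<in> edges (join P Q) \<longleftrightarrow> {u, v} \<in> edges P"
  "{Inr u', Inr v'} \<in> edges (join P Q) \<longleftrightarrow> {u', v'} \<in> edges Q"
  "{Inl u, Inr v'} \<in> edges (join P Q) \<longleftrightarrow> u \<in> verts P \<and> v' \<in> verts Q"
  "{Inr v', Inl u} \<in> edges (join P Q) \<longleftrightarrow> u \<in> verts P \<and> v' \<in> verts Q"
  unfolding edges_join
  by (auto simp: in_edges_disjoint_union not_in_edges_Inl_Inr doubleton_eq_iff)

lemma bij_betw_Plus:
  assumes "bij_betw p X P" "bij_betw q Y Q" "X \<inter> Y = {}"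
  shows "bij_betw (\<lambda>x. if x \<in> X then Inl (p x) else Inr (q x)) (X \<union> Y) (P <+> Q)"
  unfolding Plus_def
proof (rule bij_betw_combine)
  let ?f = "\<lambda>x. if x \<in> X then Inl (p x) else Inr (q x)"
  show "bij_betw ?f X (Inl ` P)"
    using assms(1) by (auto simp: bij_betw_def inj_on_def)
  have "x \<notin> X" if "x \<in> Y" for x using assms(3) that by blast
  then show "bij_betw ?f Y (Inr ` Q)"
    using assms(2) by (auto simp: bij_betw_def inj_on_def)
qed auto

text \<open>The two isomorphisms glue along the tags \<open>Inl\<close> and \<open>Inr\<close>:
  pairs inside \<open>X\<close> or inside \<open>Y\<close> are settled by \<open>p\<close> or
  \<open>q\<close>, and mixed pairs are edges on both sides.\<close>

lemma induced_iso_join: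
  assumes "induced_subgraph G X \<cong> P" "induced_subgraph G Y \<cong> Q" "X \<inter> Y = {}"
    and adj: "\<And>x y. x \<in> X \<Longrightarrow> y \<in> Y \<Longrightarrow> {x, y} \<in> edges G"
  shows "induced_subgraph G (X \<union> Y) \<cong> join P Q"
proof -
  obtain p where p: "bij_betw p X (verts P)"
    "\<And>u v. u \<in> X \<Longrightarrow> v \<in> X \<Longrightarrow> {u, v} \<in> edges G \<longleftrightarrow> {p u, p v} \<in> edges P"
    using assms(1) by (auto simp: graph_iso_def)
  obtain q where q: "bij_betw q Y (verts Q)"
    "\<And>u v. u \<in> Y \<Longrightarrow> v \<in> Y \<Longrightarrow> {u, v} \<in> edges G \<longleftrightarrow> {q u, q v} \<in> edges Q"
    using assms(2) by (auto simp: graph_iso_def)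
  let ?f = "\<lambda>x. if x \<in> X then Inl (p x) else Inr (q x)"
  have "bij_betw ?f (X \<union> Y) (verts (join P Q))"
    using bij_betw_Plus[OF p(1) q(1) assms(3)] by (simp add: join_def)
  moreover have "{u, v} \<in> edges G \<longleftrightarrow> {?f u, ?f v} \<in> edges (join P Q)"
    if "u \<in> X \<union> Y" "v \<in> X \<union> Y" for u v
    using that adj[of u v] adj[of v u] p q bij_betwE[OF p(1)] bij_betwE[OF q(1)]
    by (auto simp: in_edges_join insert_commute)
  ultimately show ?thesis unfolding graph_iso_def by (intro exI[of _ ?f]) auto
qed

text \<open>The same gluing, with mixed pairs now non-edges on both sides.\<close>

lemma induced_iso_disjoint_union:
  assumes "induced_subgraph G X \<cong> P" "induced_subgraph G Y \<cong> Q" "X \<inter> Y = {}"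
    and nadj: "\<And>x y. x \<in> X \<Longrightarrow> y \<in> Y \<Longrightarrow> {x, y} \<notin> edges G"
  shows "induced_subgraph G (X \<union> Y) \<cong> disjoint_union P Q"
proof -
  obtain p where p: "bij_betw p X (verts P)"
    "\<And>u v. u \<in> X \<Longrightarrow> v \<in> X \<Longrightarrow> {u, v} \<in> edges G \<longleftrightarrow> {p u, p v} \<in> edges P"
    using assms(1) by (auto simp: graph_iso_def)
  obtain q where q: "bij_betw q Y (verts Q)"
    "\<And>u v. u \<in> Y \<Longrightarrow> v \<in> Y \<Longrightarrow> {u, v} \<in> edges G \<longleftrightarrow> {q u, q v} \<in> edges Q"
    using assms(2) by (auto simp: graph_iso_def)
  let ?f = "\<lambda>x. if x \<in> X then Inl (p x) else Inr (q x)"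
  have "bij_betw ?f (X \<union> Y) (verts (disjoint_union P Q))"
    using bij_betw_Plus[OF p(1) q(1) assms(3)] by (simp add: disjoint_union_def)
  moreover have "{u, v} \<in> edges G \<longleftrightarrow> {?f u, ?f v} \<in> edges (disjoint_union P Q)"
    if "u \<in> X \<union> Y" "v \<in> X \<union> Y" for u v
    using that nadj[of u v] nadj[of v u] p q
    by (auto simp: in_edges_disjoint_union not_in_edges_Inl_Inr insert_commute)
  ultimately show ?thesis unfolding graph_iso_def by (intro exI[of _ ?f]) auto
qed

text \<open>Any enumeration of \<open>X\<close> serves, since in both graphs adjacency of two
  vertices just means that they differ; simplicity of \<open>G\<close> excludes loops.\<close>

lemma clique_iso_complete_graph:
  assumes G: "simple_graph G" and X: "is_clique G X"
  shows "induced_subgraph G X \<cong> complete_graph (card X)"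
proof -
  have "finite X"
    using G X by (auto simp: simple_graph_def is_clique_def intro: finite_subset)
  then obtain f where f: "bij_betw f X {0..<card X}"
    using ex_bij_betw_finite_nat by blast
  have "{u, v} \<in> edges G \<longleftrightarrow> {f u, f v} \<in> edges (complete_graph (card X))"
    if "u \<in> X" "v \<in> X" for u v
  proof -
    have "f u < card X" "f v < card X" "f u = f v \<longleftrightarrow> u = v"
      using f that by (auto simp: bij_betw_def inj_on_eq_iff)
    moreover have "{u, v} \<in> edges G \<longleftrightarrow> u \<noteq> v"
      using X that simple_graph_no_loop[OF G] by (auto simp: is_clique_def)
    ultimately show ?thesis
      by (auto simp: complete_graph_def card_insert_if)
  qed
  then show ?thesis
    using f unfolding graph_iso_def
    by (intro exI[of _ f]) (auto simp: complete_graph_def atLeast0LessThan)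
qed

section \<open>Cliques and colourings\<close>

lemma finite_cliques: "simple_graph G \<Longrightarrow> finite {card S | S. is_clique G S}"
proof -
  assume "simple_graph G"
  then have "finite (card ` Pow (verts G))" by (simp add: simple_graph_def)
  then show ?thesis by (rule rev_finite_subset) (auto simp: is_clique_def)
qed

lemma card_clique_le: "simple_graph G \<Longrightarrow> is_clique G S \<Longrightarrow> card S \<le> clique_number G"
  unfolding clique_number_def by (rule Max_ge[OF finite_cliques]) auto

lemma ex_max_clique:
  assumes "simple_graph G"
  shows "\<exists>S. is_clique G S \<and> card S = clique_number G"
proof -
  \<comment> \<open>The empty clique makes the set of sizes nonempty, as \<open>Max_in\<close>
    requires, even when \<open>G\<close> has no vertices.\<close>
  have "is_clique G {}" by (simp add: is_clique_def)
  then have "clique_number G \<in> {card S | S. is_clique G S}"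
    unfolding clique_number_def by (intro Max_in finite_cliques assms) auto
  then show ?thesis by auto
qed

lemma is_cliqueD: "is_clique G S \<Longrightarrow> u \<in> S \<Longrightarrow> v \<in> S \<Longrightarrow> u \<noteq> v \<Longrightarrow> {u, v} \<in> edges G"
  by (simp add: is_clique_def)

lemma is_clique_subset: "is_clique G S \<Longrightarrow> T \<subseteq> S \<Longrightarrow> is_clique G T"
  unfolding is_clique_def by blast

lemma is_clique_insert:
  assumes "is_clique G S" "x \<in> verts G" "\<And>y. y \<in> S \<Longrightarrow> {x, y} \<in> edges G"
  shows "is_clique G (insert x S)"
  using assms by (auto simp: is_clique_def insert_commute)

section \<open>Colourings of sets of vertices\<close>

text \<open>Fixing \<open>G\<close> and varying only the vertex set lets colourings of pieces be
  combined without changing the ambient graph.\<close>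

definition colorable :: "'a graph \<Rightarrow> 'a set \<Rightarrow> nat \<Rightarrow> bool" where
  "colorable G S k \<longleftrightarrow> (\<exists>c. is_coloring (induced_subgraph G S) k c)"

lemma colorable_iff:
  "colorable G S k \<longleftrightarrow>
     (\<exists>c :: 'a \<Rightarrow> nat. (\<forall>x\<in>S. c x < k) \<and> (\<forall>u\<in>S. \<forall>v\<in>S. {u, v} \<in> edges G \<longrightarrow> c u \<noteq> c v))"
  for G :: "'a graph"
  by (auto simp: colorable_def is_coloring_def image_subset_iff)

lemma chromatic_number_le: "colorable G (verts G) k \<Longrightarrow> chromatic_number G \<le> k"
  unfolding chromatic_number_def colorable_iff
  by (rule Least_le) (auto simp: is_coloring_def image_subset_iff)

lemma colorable_induced [simp]: "colorable (induced_subgraph G S) S k \<longleftrightarrow> colorable G S k"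
  by (simp add: colorable_def induced_subgraph_twice)

lemma colorable_mono: "colorable G S k \<Longrightarrow> k \<le> l \<Longrightarrow> colorable G S l"
  unfolding colorable_iff by (erule exE) (blast intro: order_less_le_trans)

lemma colorable_subset: "colorable G T k \<Longrightarrow> S \<subseteq> T \<Longrightarrow> colorable G S k"
  unfolding colorable_iff by (erule exE) blast

lemma colorable_Un:
  assumes "colorable G S k" "colorable G T l"
  shows "colorable G (S \<union> T) (k + l)"
proof -
  obtain c where c: "\<And>x. x \<in> S \<Longrightarrow> c x < k"
    "\<And>u v. u \<in> S \<Longrightarrow> v \<in> S \<Longrightarrow> {u, v} \<in> edges G \<Longrightarrow> c u \<noteq> c v"
    using assms(1) unfolding colorable_iff by blast
  obtain b where b: "\<And>x. x \<in> T \<Longrightarrow> b x < l"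
    "\<And>u v. u \<in> T \<Longrightarrow> v \<in> T \<Longrightarrow> {u, v} \<in> edges G \<Longrightarrow> b u \<noteq> b v"
    using assms(2) unfolding colorable_iff by blast
  \<comment> \<open>The shift by \<open>k\<close> separates the two palettes. The sets may overlap:
    on the overlap \<open>c\<close> decides.\<close>
  let ?c = "\<lambda>x. if x \<in> S then c x else k + b x"
  show ?thesis
    unfolding colorable_iff
  proof (intro exI[of _ ?c] conjI ballI impI)
    fix u v assume uv: "u \<in> S \<union> T" "v \<in> S \<union> T" "{u, v} \<in> edges G"
    show "?c u \<noteq> ?c v"
      using uv c(1)[of u] c(1)[of v] c(2)[of u v] b(2)[of u v]
      by (cases "u \<in> S"; cases "v \<in> S") simp_all
  next
    fix x assume "x \<in> S \<union> T"
    then show "?c x < k + l" using c(1)[of x] b(1)[of x] by (cases "x \<in> S") simp_all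
  qed
qed

lemma colorable_UN:
  assumes "finite I" "\<And>i. i \<in> I \<Longrightarrow> colorable G (A i) (k i)"
  shows "colorable G (\<Union>i\<in>I. A i) (\<Sum>i\<in>I. k i)"
  using assms
proof (induction I rule: finite_induct)
  case empty
  then show ?case by (simp add: colorable_iff)
next
  case (insert i I)
  then show ?case using colorable_Un[of G "A i" "k i"] by simp
qed

lemma colorable_stable: "(\<And>u v. u \<in> S \<Longrightarrow> v \<in> S \<Longrightarrow> {u, v} \<notin> edges G) \<Longrightarrow> colorable G S (Suc 0)"
  unfolding colorable_iff by (intro exI[of _ "\<lambda>_. 0"]) auto

lemma colorable_greedy:
  assumes G: "simple_graph G" and deg: "\<And>v. v \<in> verts G \<Longrightarrow> degree G v < k"
  shows "S \<subseteq> verts G \<Longrightarrow> colorable G S k"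
proof -
  assume S: "S \<subseteq> verts G"
  have fin: "finite (verts G)" using G by (simp add: simple_graph_def)
  have "finite S" using S fin by (rule finite_subset)
  then show ?thesis using S
  proof (induction S rule: finite_induct)
    case empty
    then show ?case by (simp add: colorable_iff)
  next
    case (insert x S)
    then have "colorable G S k" by simp
    then obtain c where c: "\<And>y. y \<in> S \<Longrightarrow> c y < k"
      "\<And>u v. u \<in> S \<Longrightarrow> v \<in> S \<Longrightarrow> {u, v} \<in> edges G \<Longrightarrow> c u \<noteq> c v"
      unfolding colorable_iff by blast
    \<comment> \<open>All neighbours of \<open>x\<close> are counted, coloured or not. The values of
      \<open>c\<close> outside \<open>S\<close> are arbitrary, but excluding them too still leaves
      one of the \<open>k\<close> colours free.\<close>
    let ?N = "{u \<in> verts G. {u, x} \<in> edges G}"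
    have "card (c ` ?N) \<le> card ?N" using fin by (intro card_image_le) simp
    also have "\<dots> < card {..<k}" using deg[of x] insert.prems by (simp add: degree_def)
    finally have "card (c ` ?N) < card {..<k}" .
    moreover have "finite (c ` ?N)" using fin by simp
    ultimately have "\<not> {..<k} \<subseteq> c ` ?N" using card_mono linorder_not_le by blast
    then obtain a where a: "a < k" "a \<notin> c ` ?N" by auto
    show ?case unfolding colorable_iff
    proof (intro exI[of _ "c(x := a)"] conjI ballI impI)
      fix u v assume uv: "u \<in> insert x S" "v \<in> insert x S" "{u, v} \<in> edges G"
      then have "u \<noteq> v" using simple_graph_no_loop[OF G] by blast
      with uv a c(2)[of u v] insert show "(c(x := a)) u \<noteq> (c(x := a)) v"
        by (auto simp: insert_commute)
    qed (use a c in auto)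
  qed
qed

section \<open>The bounding function\<close>

lemma g_1 [simp]: "g n d (Suc 0) = 1"
  by (cases d) auto

text \<open>The sum also covers \<open>\<omega> \<le> 1\<close>, and \<open>j = \<omega> - k + 1\<close> makes its summands monotone in \<open>\<omega>\<close>.\<close>

lemma g_Suc_reindexed:
  "g n (Suc d) \<omega> = (\<Sum>j = 1..\<omega>. j * g (max (n - Suc j) (2 * Suc d)) d (Suc \<omega> - j))"
proof -
  have "g n (Suc d) \<omega> =
      (\<Sum>k = 1..\<omega>. (\<omega> - k + 1) * g (max (n + k - \<omega> - 2) (2 * Suc d)) d k)"
    by auto
  also have "\<dots> = (\<Sum>j = 1..\<omega>. j * g (max (n - Suc j) (2 * Suc d)) d (Suc \<omega> - j))"
  proof (rule sum.reindex_bij_witness[of _ "\<lambda>j. Suc \<omega> - j" "\<lambda>k. Suc \<omega> - k"])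
    fix k assume k: "k \<in> {1..\<omega>}"
    then have "n - Suc (Suc \<omega> - k) = n + k - \<omega> - 2" "Suc \<omega> - (Suc \<omega> - k) = k"
      "Suc \<omega> - k = \<omega> - k + 1"
      by auto
    then show "(Suc \<omega> - k) * g (max (n - Suc (Suc \<omega> - k)) (2 * Suc d)) d (Suc \<omega> - (Suc \<omega> - k)) =
      (\<omega> - k + 1) * g (max (n + k - \<omega> - 2) (2 * Suc d)) d k"
      by (simp only:)
  qed auto
  finally show ?thesis .
qed

text \<open>In the reindexed sum, passing from \<open>a\<close> to \<open>b\<close> first raises the
  last argument of each summand and then adds further summands. The bound on \<open>n\<close> gives
  \<open>1 \<le> n - 1\<close> in the base case, and the maximum inside \<open>?m\<close> restores
  it for the induction hypothesis.\<close>

lemma g_mono: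
  assumes "n \<ge> 2 * Suc d" "a \<le> b"
  shows "g n d a \<le> g n d b"
  using assms
proof (induction d arbitrary: n a b)
  case 0
  then show ?case by auto
next
  case (Suc d)
  let ?m = "\<lambda>j. max (n - Suc j) (2 * Suc d)"
  have "g n (Suc d) a \<le> (\<Sum>j = 1..a. j * g (?m j) d (Suc b - j))"
    unfolding g_Suc_reindexed using Suc.prems
    by (intro sum_mono mult_le_mono order.refl Suc.IH) auto
  also have "\<dots> \<le> g n (Suc d) b"
    unfolding g_Suc_reindexed using Suc.prems by (intro sum_mono2) auto
  finally show ?case .
qed

section \<open>The induction on d\<close>

text \<open>A vertex of degree at least \<open>n - 1\<close>, together with \<open>n - 1\<close> of
  its neighbours, would induce a copy of a member of \<open>B n 0\<close>.\<close>

lemma degree_less_of_free: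
  assumes G: "simple_graph G" and free: "is_free (B n 0) G" and n: "n \<ge> 2" and v: "v \<in> verts G"
  shows "degree G v < n - 1"
proof (rule ccontr)
  assume "\<not> degree G v < n - 1"
  then have "n - 1 \<le> card {u \<in> verts G. {u, v} \<in> edges G}" by (simp add: degree_def)
  then obtain N where N: "N \<subseteq> {u \<in> verts G. {u, v} \<in> edges G}" "card N = n - 1" "finite N"
    by (rule obtain_subset_with_card_n)
  have vN: "v \<notin> N" using N(1) simple_graph_no_loop[OF G, of v v] by blast
  define T where "T = insert v N"
  have T: "T \<subseteq> verts G" "finite T" "card T = n"
    using N v vN n by (auto simp: T_def)
  have sT: "simple_graph (induced_subgraph G T)"
    by (rule simple_graph_induced[OF G T(1)])
  have "{u \<in> verts (induced_subgraph G T). {u, v} \<in> edges (induced_subgraph G T)} = N"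
    using N simple_graph_no_loop[OF G] by (auto simp: T_def)
  then have deg_v: "degree (induced_subgraph G T) v = n - 1"
    using N by (simp add: degree_def)
  have deg_le: "degree (induced_subgraph G T) w \<le> n - 1" if "w \<in> T" for w
  proof -
    have "degree (induced_subgraph G T) w \<le> card (T - {w})"
      unfolding degree_def using T simple_graph_no_loop[OF G]
      by (intro card_mono) auto
    then show ?thesis using that T by simp
  qed
  have "max_degree (induced_subgraph G T) = n - 1"
    unfolding max_degree_def
    using T deg_le deg_v by (intro Max_eqI) (auto simp: T_def image_iff)
  moreover obtain H :: "nat graph" where H: "simple_graph H" "induced_subgraph G T \<cong> H"
    using ex_nat_copy[OF sT] by blast
  ultimately have "H \<in> B n 0"
    using T card_verts_iso[OF H(2)] max_degree_iso[OF H(2)] by simp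
  with H T free show False unfolding is_free_def by blast
qed

text \<open>A copy of some \<open>F\<close> from \<open>B m d\<close> inside \<open>A\<close> would
  grow to a forbidden graph: the edge \<open>{a, b}\<close> is the \<open>K_2\<close> beside
  \<open>F\<close>, and \<open>n - m - 2\<close> vertices of \<open>K\<close> are joined to both.
  The conditions on \<open>m\<close> say that it is an admissible index in
  \<open>B n (Suc d)\<close> and that \<open>K\<close> has enough vertices.\<close>

lemma is_free_anticomplete_to_edge:
  assumes G: "simple_graph G" and free: "is_free (B n (Suc d)) G"
    and A: "A \<subseteq> verts G"
    and K: "is_clique G (insert a (insert b K))" "a \<noteq> b" "a \<notin> K" "b \<notin> K"
    and K_A: "\<And>x y. x \<in> K \<Longrightarrow> y \<in> A \<Longrightarrow> {x, y} \<in> edges G"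
    and ab_A: "\<And>y. y \<in> A \<Longrightarrow> {a, y} \<notin> edges G" "\<And>y. y \<in> A \<Longrightarrow> {b, y} \<notin> edges G"
    and m: "2 * Suc d \<le> m" "m + 2 \<le> n" "n \<le> card K + m + 2"
  shows "is_free (B m d) (induced_subgraph G A)"
  unfolding is_free_def
proof (intro notI, elim exE conjE)
  fix S F
  assume "S \<subseteq> verts (induced_subgraph G A)" and F: "F \<in> B m d"
    and iso: "induced_subgraph (induced_subgraph G A) S \<cong> F"
  then have S: "S \<subseteq> A" and SF: "induced_subgraph G S \<cong> F"
    by (simp_all add: induced_subgraph_twice)
  have "n - m - 2 \<le> card K" using m by simp
  then obtain L where L: "L \<subseteq> K" "card L = n - m - 2" "finite L"
    by (rule obtain_subset_with_card_n)
  have cliques: "is_clique G L" "is_clique G {a, b}"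
    by (rule is_clique_subset[OF K(1)]; use L in blast)+
  have "{a, b} \<in> edges G" "{b, a} \<in> edges G"
    using is_cliqueD[OF K(1), of a b] is_cliqueD[OF K(1), of b a] K(2) by simp_all
  \<comment> \<open>If one end of the edge lay in \<open>A\<close>, the other end would be
    nonadjacent to it.\<close>
  then have aA: "a \<notin> A" "b \<notin> A" using ab_A by blast+
  have LY: "{x, y} \<in> edges G" if xy: "x \<in> L" "y \<in> {a, b} \<union> S" for x y
  proof (cases "y \<in> S")
    case True
    then show ?thesis using K_A L S xy by blast
  next
    case False
    then have "y \<in> {a, b}" using xy by blast
    moreover have "x \<in> K" using xy L by blast
    ultimately show ?thesis using is_cliqueD[OF K(1), of x y] K by auto
  qed
  have LS: "x \<notin> S" if "x \<in> L" for x
    using LY[of x x] that simple_graph_no_loop[OF G, of x x] by blast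
  define T where "T = L \<union> ({a, b} \<union> S)"
  have "induced_subgraph G {a, b} \<cong> complete_graph 2"
    using clique_iso_complete_graph[OF G cliques(2)] K(2) by (simp add: numeral_2_eq_2)
  then have "induced_subgraph G ({a, b} \<union> S) \<cong> disjoint_union (complete_graph 2) F"
  proof (rule induced_iso_disjoint_union[OF _ SF])
    show "{a, b} \<inter> S = {}" using aA S by blast
    show "{x, y} \<notin> edges G" if "x \<in> {a, b}" "y \<in> S" for x y
      using that ab_A S by blast
  qed
  then have iso_T: "induced_subgraph G T \<cong>
      join (complete_graph (n - m - 2)) (disjoint_union (complete_graph 2) F)"
    unfolding T_def
  proof (rule induced_iso_join[rotated])
    show "{x, y} \<in> edges G" if "x \<in> L" "y \<in> {a, b} \<union> S" for x y
      using that by (rule LY)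
    show "induced_subgraph G L \<cong> complete_graph (n - m - 2)"
      using clique_iso_complete_graph[OF G cliques(1)] L(2) by simp
    show "L \<inter> ({a, b} \<union> S) = {}" using LS L(1) K by blast
  qed
  have T: "T \<subseteq> verts G"
    using cliques[unfolded is_clique_def, THEN conjunct1] S A unfolding T_def by blast
  obtain H :: "nat graph" where H: "simple_graph H" "induced_subgraph G T \<cong> H"
    using ex_nat_copy[OF simple_graph_induced[OF G T]] by blast
  \<comment> \<open>\<open>B n (Suc d)\<close> contains every simple copy on natural numbers of the
    constructed join, so composing the two isomorphisms suffices.\<close>
  have "H \<in> B n (Suc d)"
    using H(1) graph_iso_trans[OF graph_iso_sym[OF H(2)] iso_T] F m by auto
  with H T free show False unfolding is_free_def by blast
qed

text \<open>A largest clique inside \<open>A\<close> together with \<open>K\<close> is a clique of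
  \<open>G\<close>. The two are disjoint because a common vertex would be adjacent to
  itself.\<close>

lemma clique_number_joined_to_clique:
  assumes G: "simple_graph G" and A: "A \<subseteq> verts G" and K: "is_clique G K"
    and K_A: "\<And>x y. x \<in> K \<Longrightarrow> y \<in> A \<Longrightarrow> {x, y} \<in> edges G"
  shows "clique_number (induced_subgraph G A) + card K \<le> clique_number G"
proof -
  obtain S where S: "is_clique (induced_subgraph G A) S"
    "card S = clique_number (induced_subgraph G A)"
    using ex_max_clique[OF simple_graph_induced[OF G A]] by blast
  have SA: "S \<subseteq> A" and clique_S: "\<And>u v. u \<in> S \<Longrightarrow> v \<in> S \<Longrightarrow> u \<noteq> v \<Longrightarrow> {u, v} \<in> edges G"
    using S(1) by (auto simp: is_clique_def)
  have "S \<inter> K = {}" using K_A SA simple_graph_no_loop[OF G] by blast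
  moreover have "finite S" "finite K"
    using G SA A K by (auto simp: simple_graph_def is_clique_def intro: finite_subset)
  ultimately have "card (S \<union> K) = card S + card K" by (rule card_Un_disjoint[rotated 2])
  moreover have "is_clique G (S \<union> K)"
    unfolding is_clique_def
  proof (intro conjI ballI impI)
    show "S \<union> K \<subseteq> verts G" using SA A K by (auto simp: is_clique_def)
    fix u v assume "u \<in> S \<union> K" "v \<in> S \<union> K" "u \<noteq> v"
    then show "{u, v} \<in> edges G"
      using clique_S[of u v] K K_A[of u v] K_A[of v u] SA
      by (auto simp: is_clique_def insert_commute)
  qed
  ultimately show ?thesis using card_clique_le[OF G, of "S \<union> K"] S(2) by simp
qed

text \<open>The induction generalises over \<open>n\<close> and \<open>G\<close>, because the pieces
  are induced subgraphs that avoid a family with a different first index. Induced subgraphs keep the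
  vertex type, so the hypothesis applies to them directly.\<close>

lemma colorable_of_free:
  assumes "n \<ge> 2 * Suc d" "simple_graph G" "is_free (B n d) G"
  shows "colorable G (verts G) (g n d (clique_number G))"
  using assms
proof (induction d arbitrary: n G)
  case (0 n G)
  note G = \<open>simple_graph G\<close>
  have single: "is_clique G {v}" if "v \<in> verts G" for v
    using that by (simp add: is_clique_def)
  consider "clique_number G = 0" | "clique_number G = 1" | "clique_number G > 1" by linarith
  then show ?case
  proof cases
    case 1
    \<comment> \<open>No colour is available here, so the graph must be empty: a single vertex is
      already a clique.\<close>
    then have "verts G = {}" using card_clique_le[OF G single] by fastforce
    then show ?thesis by (simp add: colorable_iff)
  next
    case 2
    have "{u, v} \<notin> edges G" for u v
    proof
      assume uv: "{u, v} \<in> edges G"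
      then have "is_clique G {u, v}" "card {u, v} = 2"
        using G by (auto simp: is_clique_def simple_graph_def insert_commute)
      then show False using card_clique_le[OF G, of "{u, v}"] 2 by simp
    qed
    then show ?thesis using 2 by (simp add: colorable_stable)
  next
    case 3
    then show ?thesis
      using colorable_greedy[OF G degree_less_of_free[OF G 0(3)]] 0 by simp
  qed
next
  case (Suc d n G)
  note G = \<open>simple_graph G\<close>
  let ?w = "clique_number G" and ?V = "verts G"
  obtain Q where Q: "is_clique G Q" "card Q = ?w"
    using ex_max_clique[OF G] by blast
  have "finite Q" using G Q by (auto simp: simple_graph_def is_clique_def intro: finite_subset)
  then obtain v where v: "bij_betw v {..<?w} Q"
    using Q(2) ex_bij_betw_nat_finite[of Q] by (auto simp: atLeast0LessThan)
  have v_in: "v i \<in> Q" if "i < ?w" for i using v that by (auto simp: bij_betw_def)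
  have v_eq: "v i = v j \<longleftrightarrow> i = j" if "i < ?w" "j < ?w" for i j
    using v that by (auto simp: bij_betw_def inj_on_eq_iff)
  have Q_eq: "Q = v ` {..<?w}" using v by (simp add: bij_betw_def)
  have subclique: "is_clique G K" if "K \<subseteq> Q" for K
    using Q(1) that by (auto simp: is_clique_def)
  have misses: "\<exists>i<?w. {x, v i} \<notin> edges G" if "x \<in> ?V" for x
  proof (rule ccontr)
    assume "\<not> (\<exists>i<?w. {x, v i} \<notin> edges G)"
    then have adj: "{x, y} \<in> edges G" if "y \<in> Q" for y using that by (auto simp: Q_eq)
    then have "x \<notin> Q" using simple_graph_no_loop[OF G] by blast
    moreover have "is_clique G (insert x Q)" using Q(1) \<open>x \<in> ?V\<close> adj by (rule is_clique_insert)
    ultimately show False using card_clique_le[OF G] \<open>finite Q\<close> Q(2) by fastforce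
  qed
  define A where "A = (\<lambda>j i. {x \<in> ?V. {x, v i} \<notin> edges G \<and> (j < ?w \<longrightarrow> {x, v j} \<notin> edges G) \<and>
    (\<forall>l<j. l \<noteq> i \<longrightarrow> {x, v l} \<in> edges G)})"
  \<comment> \<open>For \<open>j = clique_number G\<close> there is no second missed vertex.\<close>
  let ?m = "\<lambda>j. max (n - Suc j) (2 * Suc d)"
  have cover: "?V \<subseteq> (\<Union>j\<in>{1..?w}. \<Union>i\<in>{..<j}. A j i)"
  proof
    fix x assume x: "x \<in> ?V"
    define i where "i = (LEAST i. {x, v i} \<notin> edges G)"
    obtain i' where i': "i' < ?w" "{x, v i'} \<notin> edges G" using misses[OF x] by blast
    have i: "{x, v i} \<notin> edges G" "\<And>l. l < i \<Longrightarrow> {x, v l} \<in> edges G"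
      using LeastI[of "\<lambda>i. {x, v i} \<notin> edges G", OF i'(2)]
        not_less_Least[of _ "\<lambda>i. {x, v i} \<notin> edges G"]
      unfolding i_def by blast+
    have "i \<le> i'" unfolding i_def using i'(2) by (rule Least_le)
    then have iw: "i < ?w" using i'(1) by simp
    \<comment> \<open>The clique number itself satisfies \<open>P\<close>, so the least such
      \<open>j\<close> exists; it is the index of the second missed vertex, or the clique number if
      there is none.\<close>
    define P where "P = (\<lambda>j. i < j \<and> j \<le> ?w \<and> (j < ?w \<longrightarrow> {x, v j} \<notin> edges G))"
    have "P ?w" using iw by (simp add: P_def)
    define j where "j = (LEAST j. P j)"
    have j: "P j" using \<open>P ?w\<close> unfolding j_def by (rule LeastI)
    have "{x, v l} \<in> edges G" if "l < j" "l \<noteq> i" for l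
    proof (cases "l < i")
      case False
      have "\<not> P l" using that(1) unfolding j_def by (rule not_less_Least)
      then show ?thesis using that False j by (auto simp: P_def)
    qed (use i in blast)
    then have "x \<in> A j i" using x i j by (auto simp: A_def P_def)
    then show "x \<in> (\<Union>j\<in>{1..?w}. \<Union>i\<in>{..<j}. A j i)"
      using j by (force simp: P_def)
  qed
  have "colorable G (A j i) (g (?m j) d (Suc ?w - j))" if "j \<in> {1..?w}" "i < j" for i j
  proof -
    have ij: "i < j" "j \<le> ?w" "i < ?w" using that by auto
    define K where "K = v ` ({..<j} - {i})"
    have "inj_on v ({..<j} - {i})"
      by (rule inj_on_subset[OF bij_betw_imp_inj_on[OF v]]) (use ij in auto)
    then have card_K: "card K = j - 1" unfolding K_def using ij by (simp add: card_image)
    have KQ: "K \<subseteq> Q" unfolding K_def using ij v_in by auto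
    have K_A: "{x, y} \<in> edges G" if "x \<in> K" "y \<in> A j i" for x y
      using that by (auto simp: K_def A_def insert_commute)
    have A_V: "A j i \<subseteq> ?V" by (auto simp: A_def)
    have "clique_number (induced_subgraph G (A j i)) + card K \<le> ?w"
      by (rule clique_number_joined_to_clique[OF G A_V subclique[OF KQ] K_A])
    then have cn: "clique_number (induced_subgraph G (A j i)) \<le> Suc ?w - j"
      using card_K ij by simp
    have m_ge: "?m j \<ge> 2 * Suc d" by simp
    show ?thesis
    proof (cases "j = ?w")
      case True
      \<comment> \<open>No second missed vertex is available to form an edge, but the bound on the
        clique number of the piece is now 1. The piece is therefore stable, and \<open>g\<close> is
        1 there whatever its other arguments are.\<close>
      have "{x, y} \<notin> edges G" if "x \<in> A j i" "y \<in> A j i" for x y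
      proof
        assume xy: "{x, y} \<in> edges G"
        have "is_clique (induced_subgraph G (A j i)) {x, y}"
          using that xy by (auto simp: is_clique_def insert_commute)
        moreover have "card {x, y} = 2" using xy G by (auto simp: simple_graph_def)
        ultimately show False
          using card_clique_le[OF simple_graph_induced[OF G A_V], of "{x, y}"] cn True by simp
      qed
      then have "colorable G (A j i) (Suc 0)" by (rule colorable_stable)
      then show ?thesis using True by (simp add: Suc_diff_le)
    next
      case False
      then have jw: "j < ?w" using ij by simp
      have "is_free (B (?m j) d) (induced_subgraph G (A j i))"
      proof (rule is_free_anticomplete_to_edge[OF G Suc.prems(3) A_V, of "v i" "v j" K])
        show "is_clique G (insert (v i) (insert (v j) K))"
          using KQ v_in ij jw by (intro subclique) auto
        show "v i \<noteq> v j" "v i \<notin> K" "v j \<notin> K"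
          unfolding K_def using v_eq ij jw by auto
        show "{v i, y} \<notin> edges G" "{v j, y} \<notin> edges G" if "y \<in> A j i" for y
          using that jw by (auto simp: A_def insert_commute)
        \<comment> \<open>On the left, \<open>j \<ge> 1\<close> handles the first entry of the
          maximum and \<open>n \<ge> 2 * Suc (Suc d)\<close> the second. On the right,
          \<open>card K = j - 1\<close> and \<open>?m j \<ge> n - Suc j\<close> suffice.\<close>
        show "?m j + 2 \<le> n" "n \<le> card K + ?m j + 2"
          using Suc.prems(1) card_K ij by auto
      qed (simp_all add: K_A)
      then have "colorable G (A j i) (g (?m j) d (clique_number (induced_subgraph G (A j i))))"
        using Suc.IH[OF m_ge simple_graph_induced[OF G A_V]] by simp
      then show ?thesis by (rule colorable_mono) (rule g_mono[OF m_ge cn])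
    qed
  qed
  then have "colorable G (\<Union>i\<in>{..<j}. A j i) (\<Sum>i\<in>{..<j}. g (?m j) d (Suc ?w - j))"
    if "j \<in> {1..?w}" for j
    using that by (intro colorable_UN) auto
  \<comment> \<open>The inner sum is constant in \<open>i\<close>, and its \<open>j\<close> terms
    produce the factor \<open>j\<close> of the reindexed recursion.\<close>
  then have "colorable G (\<Union>j\<in>{1..?w}. \<Union>i\<in>{..<j}. A j i) (g n (Suc d) ?w)"
    unfolding g_Suc_reindexed by (intro colorable_UN) auto
  then show ?case using cover by (rule colorable_subset)
qed

theorem mainTheorem7:
  fixes n d :: nat and G :: "'a graph"
  assumes "n \<ge> 2 * (d + 1)"
    and "simple_graph G"
    and "is_free (B n d) G"
  shows "chromatic_number G \<le> g n d (clique_number G)"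
  using colorable_of_free[of d n G] assms by (intro chromatic_number_le) simp

end
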